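(* There exists a quadratic normalisation $(S,N)$ of class $(4,4)$ such that the associated rewriting system $(S,R)$, with $R=\{s|t\to \overline N(s|t) \mid s,t\in S,\ s|t\neq\overline N(s|t)\}$, is not terminating (that is, it admits an infinite rewriting sequence).
   Context: $S^*$ is the set of finite words over a set $S$, $\|w\|$ is the length of $w$, $|$ denotes concatenation, and $S^{[p]}$ is the set of words of length $p$. A normalisation is a pair $(S,N)$ with $S$ a set and $N:S^*\to S^*$ satisfying, for all words $u,v,w$: $\|N(w)\|=\|w\|$; $\|w\|=1$ implies $N(w)=w$; $N(u|N(w)|v)=N(u|w|v)$. A word $w$ is $N$-normal if $N(w)=w$. $\overline N$ denotes the restriction of $N$ to $S^{[2]}$; $\overline N_i$ is the partial map on $S^*$ applying $\overline N$ to the entries in positions $i,i+1$; for a finite sequence $u=i_1|\cdots|i_n$ of positive integers, $\overline N_u:=\overline N_{i_n}\circ\cdots\circ\overline N_{i_1}$ ($\overline N_{i_1}$ applied first). $(S,N)$ is quadratic if (i) a word is $N$-normal if and only if all its length-two factors are, and (ii) for every word $w$ there is a finite sequence of positions $u$, depending on $w$, with $N(w)=\overline N_u(w)$. A quadratic normalisation is of left class $c$ if $N(w)=\overline N_{121\ldots[c]}(w)$ for every $w\in S^{[3]}$, where $121\ldots[c]$ is the alternating sequence $1,2,1,\ldots$ of length $c$; it is of right class $c'$ if $N(w)=\overline N_{212\ldots[c']}(w)$ for every $w\in S^{[3]}$, where $212\ldots[c']$ is the alternating sequence $2,1,2,\ldots$ of length $c'$; it is of class $(c,c')$ if it is of left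 class $c$ and right class $c'$. A rewriting step of $(S,R)$ replaces a factor of a word equal to the left-hand side of a rule of $R$ by its right-hand side. *)

theory Defs
  imports Main
begin

text \<open>Words over \<open>S\<close> are the elements of \<^term>\<open>lists S\<close>. As \<open>S\<close> is a set rather than a type,
  the values of \<open>N\<close> on lists outside \<^term>\<open>lists S\<close> play no role.\<close>

definition words_of_length :: "'a set \<Rightarrow> nat \<Rightarrow> 'a list set" where
  "words_of_length S p = {w \<in> lists S. length w = p}"

definition normalisation :: "'a set \<Rightarrow> ('a list \<Rightarrow> 'a list) \<Rightarrow> bool" where
  "normalisation S N \<longleftrightarrow>
     (\<forall>w \<in> lists S. N w \<in> lists S) \<and>
     (\<forall>w \<in> lists S. length (N w) = length w) \<and>
     (\<forall>w \<in> lists S. length w = 1 \<longrightarrow> N w = w) \<and>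
     (\<forall>u \<in> lists S. \<forall>v \<in> lists S. \<forall>w \<in> lists S. N (u @ N w @ v) = N (u @ w @ v))"

definition normal_word :: "('a list \<Rightarrow> 'a list) \<Rightarrow> 'a list \<Rightarrow> bool" where
  "normal_word N w \<longleftrightarrow> N w = w"

text \<open>The partial map normalising the factor in positions \<open>i, i + 1\<close>. Positions are counted
  from 1, hence the shift with respect to list indices.\<close>

definition norm_at :: "('a list \<Rightarrow> 'a list) \<Rightarrow> nat \<Rightarrow> 'a list \<Rightarrow> 'a list option" where
  "norm_at N i w =
     (if 1 \<le> i \<and> i < length w
      then Some (take (i - 1) w @ N [w ! (i - 1), w ! i] @ drop (i + 1) w)
      else None)"

fun norm_seq :: "('a list \<Rightarrow> 'a list) \<Rightarrow> nat list \<Rightarrow> 'a list \<Rightarrow> 'a list option" where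
  "norm_seq N [] w = Some w"
| "norm_seq N (i # u) w = Option.bind (norm_at N i w) (norm_seq N u)"

definition quadratic_normalisation :: "'a set \<Rightarrow> ('a list \<Rightarrow> 'a list) \<Rightarrow> bool" where
  "quadratic_normalisation S N \<longleftrightarrow>
     normalisation S N \<and>
     (\<forall>w \<in> lists S. normal_word N w \<longleftrightarrow>
        (\<forall>u x v. w = u @ x @ v \<and> length x = 2 \<longrightarrow> normal_word N x)) \<and>
     (\<forall>w \<in> lists S. \<exists>u. norm_seq N u w = Some (N w))"

fun alternating :: "nat \<Rightarrow> nat \<Rightarrow> nat \<Rightarrow> nat list" where
  "alternating i j 0 = []"
| "alternating i j (Suc c) = i # alternating j i c"

definition left_class :: "'a set \<Rightarrow> ('a list \<Rightarrow> 'a list) \<Rightarrow> nat \<Rightarrow> bool" where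
  "left_class S N c \<longleftrightarrow>
     (\<forall>w \<in> words_of_length S 3. norm_seq N (alternating 1 2 c) w = Some (N w))"

definition right_class :: "'a set \<Rightarrow> ('a list \<Rightarrow> 'a list) \<Rightarrow> nat \<Rightarrow> bool" where
  "right_class S N c \<longleftrightarrow>
     (\<forall>w \<in> words_of_length S 3. norm_seq N (alternating 2 1 c) w = Some (N w))"

definition of_class :: "'a set \<Rightarrow> ('a list \<Rightarrow> 'a list) \<Rightarrow> nat \<Rightarrow> nat \<Rightarrow> bool" where
  "of_class S N c c' \<longleftrightarrow> left_class S N c \<and> right_class S N c'"

definition associated_rules :: "'a set \<Rightarrow> ('a list \<Rightarrow> 'a list) \<Rightarrow> ('a list \<times> 'a list) set" where
  "associated_rules S N = {([s, t], N [s, t]) | s t. s \<in> S \<and> t \<in> S \<and> [s, t] \<noteq> N [s, t]}"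

definition rewriting_step :: "'a set \<Rightarrow> ('a list \<times> 'a list) set \<Rightarrow> ('a list \<times> 'a list) set" where
  "rewriting_step S R =
     {(u @ l @ v, u @ r @ v) | u l r v. u \<in> lists S \<and> v \<in> lists S \<and> (l, r) \<in> R}"

definition terminating :: "'a set \<Rightarrow> ('a list \<times> 'a list) set \<Rightarrow> bool" where
  "terminating S R \<longleftrightarrow>
     \<not> (\<exists>w :: nat \<Rightarrow> 'a list. \<forall>n. (w n, w (Suc n)) \<in> rewriting_step S R)"

end

(* The letters 0; 1, 2, 3; 4, 5, 6; 7 stand for a; b, b', b''; c, c', c''; d, and the rules are
     ab -> ab',  b'c' -> bc,  bc' -> b''c'',  b'c -> b''c'',  cd -> c'd,
   all other naturals being inert. They admit the cycle abcd -> ab'cd -> ab'c'd -> abcd, but every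
   word also reduces to a unique irreducible word: a letter in front of an irreducible word is
   absorbed by changing at most the first three letters, and iterating this absorption gives a
   normal form that is invariant under the rules. *)
theory Submission
  imports Defs
begin

text \<open>Pairs without a rule are fixed, so irreducibility is a fixed-point condition on adjacent
  letters. No left-hand side contains 3 or 6, which makes b''c'' a dead end.\<close>

definition rule_map :: "nat \<Rightarrow> nat \<Rightarrow> nat \<times> nat" where
  "rule_map s t =
     (if s = 0 \<and> t = 1 then (0, 2)
      else if s = 2 \<and> t = 5 then (1, 4)
      else if s = 1 \<and> t = 5 \<or> s = 2 \<and> t = 4 then (3, 6)
      else if s = 4 \<and> t = 7 then (5, 7)
      else (s, t))"

abbreviation irreducible :: "nat list \<Rightarrow> bool" where
  "irreducible \<equiv> successively (\<lambda>s t. rule_map s t = (s, t))"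

text \<open>Meaningful only when the second argument is irreducible. In the two exceptional cases the
  reduction continues beyond the first rule: \<open>abc \<rightarrow> ab'c \<rightarrow> ab''c''\<close> and
  \<open>b'c'd \<rightarrow> bcd \<rightarrow> bc'd \<rightarrow> b''c''d\<close>.\<close>

fun absorb :: "nat \<Rightarrow> nat list \<Rightarrow> nat list" where
  "absorb x [] = [x]"
| "absorb x [y] = (case rule_map x y of (s, t) \<Rightarrow> [s, t])"
| "absorb x (y # z # w) =
     (if x = 0 \<and> y = 1 \<and> z = 4 then 0 # 3 # 6 # w
      else if x = 2 \<and> y = 5 \<and> z = 7 then 3 # 6 # 7 # w
      else case rule_map x y of (s, t) \<Rightarrow> s # t # z # w)"

definition nf :: "nat list \<Rightarrow> nat list" where
  "nf w = foldr absorb w []"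

lemma nf_Nil [simp]: "nf [] = []"
  and nf_Cons [simp]: "nf (x # w) = absorb x (nf w)"
  by (simp_all add: nf_def)

lemma length_absorb [simp]: "length (absorb x w) = Suc (length w)"
  by (cases "(x, w)" rule: absorb.cases) (auto split: prod.splits)

lemma length_nf [simp]: "length (nf w) = length w"
  by (induction w) auto

text \<open>The danger lies just behind a rewritten pair: after ab -> ab' a following c, after b'c'
  -> bc a following d. The two exceptional clauses of \<open>absorb\<close> treat exactly
  these.\<close>

lemma irreducible_absorb:
  assumes "irreducible w"
  shows "irreducible (absorb x w)"
proof (cases "(x, w)" rule: absorb.cases)
  case (3 x y z v)
  with assms show ?thesis
    by (cases v) (auto simp: rule_map_def split: if_splits)
qed (auto simp: rule_map_def split: if_splits)

lemma irreducible_nf: "irreducible (nf w)"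
  by (induction w) (auto simp: irreducible_absorb)

lemma absorb_irreducible: "irreducible (x # w) \<Longrightarrow> absorb x w = x # w"
  by (cases "(x, w)" rule: absorb.cases) (auto simp: rule_map_def split: if_splits)

lemma nf_irreducible: "irreducible w \<Longrightarrow> nf w = w"
proof (induction w)
  case (Cons x w)
  then have "irreducible w" by (cases w) auto
  with Cons show ?case by (simp add: absorb_irreducible)
qed simp

text \<open>This is the confluence check, one case per rule. The delicate overlap is abc': directly
  it gives ab''c'', and through ab'c' -> abc -> ab'c it ends there too.\<close>

lemma absorb_rule_map:
  assumes "irreducible w" "rule_map s t = (s', t')"
  shows "absorb s' (absorb t' w) = absorb s (absorb t w)"
proof -
  from assms(2) consider "s' = s" "t' = t" | "s = 0" "t = 1" "s' = 0" "t' = 2"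
    | "s = 2" "t = 5" "s' = 1" "t' = 4" | "s = 1" "t = 5" "s' = 3" "t' = 6"
    | "s = 2" "t = 4" "s' = 3" "t' = 6" | "s = 4" "t = 7" "s' = 5" "t' = 7"
    by (auto simp: rule_map_def split: if_splits)
  then show ?thesis
  proof cases
    case 1
    then show ?thesis by simp
  next
    case 2
    \<comment> \<open>Both sides inspect at most two letters of \<open>w\<close>;
      \<open>remdups_adj.cases\<close> separates lengths 0, 1 and at least 2.\<close>
    with assms(1) show ?thesis
      by (cases w rule: remdups_adj.cases) (auto simp: rule_map_def split: if_splits)
  next
    case 3
    with assms(1) show ?thesis
      by (cases w rule: remdups_adj.cases) (auto simp: rule_map_def split: if_splits)
  next
    case 4
    with assms(1) show ?thesis
      by (cases w rule: remdups_adj.cases) (auto simp: rule_map_def split: if_splits)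
  next
    case 5
    with assms(1) show ?thesis
      by (cases w rule: remdups_adj.cases) (auto simp: rule_map_def split: if_splits)
  next
    case 6
    with assms(1) show ?thesis
      by (cases w rule: remdups_adj.cases) (auto simp: rule_map_def split: if_splits)
  qed
qed

lemma nf_append: "nf (u @ w) = foldr absorb u (nf w)"
  by (simp add: nf_def)

lemma nf_pair: "nf [s, t] = (case rule_map s t of (s', t') \<Rightarrow> [s', t'])"
  by simp

text \<open>The word to the right of the pair enters only through its normal form, which is
  irreducible, so \<open>absorb_rule_map\<close> applies; the letters to the left are then absorbed
  into equal words.\<close>

lemma nf_norm_at:
  assumes "norm_at nf i w = Some w'"
  shows "nf (u @ w' @ v) = nf (u @ w @ v)"
proof -
  from assms have i: "1 \<le> i" "i < length w"
    and w': "w' = take (i - 1) w @ nf [w ! (i - 1), w ! i] @ drop (i + 1) w"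
    by (auto simp: norm_at_def simp del: nf_Cons split: if_splits)
  from i have "drop (i - 1) w = w ! (i - 1) # w ! i # drop (i + 1) w"
    by (metis Cons_nth_drop_Suc One_nat_def Suc_eq_plus1 Suc_pred less_imp_diff_less less_eq_Suc_le)
  then have w: "w = take (i - 1) w @ [w ! (i - 1), w ! i] @ drop (i + 1) w"
    by (metis append_Cons append_Nil append_take_drop_id)
  obtain s t where st: "rule_map (w ! (i - 1)) (w ! i) = (s, t)" by fastforce
  have "nf ([s, t] @ drop (i + 1) w @ v) = nf ([w ! (i - 1), w ! i] @ drop (i + 1) w @ v)"
    using absorb_rule_map[OF irreducible_nf st] by simp
  then have "nf (u @ w' @ v) = nf (u @ (take (i - 1) w @ [w ! (i - 1), w ! i] @ drop (i + 1) w) @ v)"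
    using st unfolding w' nf_pair by (simp add: nf_append)
  with w show ?thesis by metis
qed

lemma nf_norm_seq: "norm_seq nf p w = Some w' \<Longrightarrow> nf (u @ w' @ v) = nf (u @ w @ v)"
proof (induction p arbitrary: w)
  case (Cons i p)
  then obtain w1 where "norm_at nf i w = Some w1" "norm_seq nf p w1 = Some w'"
    by (auto simp: bind_eq_Some_conv)
  with Cons.IH nf_norm_at show ?case by metis
qed simp

lemma norm_seq_append: "norm_seq N (p @ q) w = Option.bind (norm_seq N p w) (norm_seq N q)"
  by (induction p arbitrary: w) (auto split: bind_splits)

lemma norm_at_Cons: "norm_at N i w = Some w' \<Longrightarrow> norm_at N (Suc i) (x # w) = Some (x # w')"
  by (cases i) (auto simp: norm_at_def split: if_splits)

lemma norm_seq_Cons: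
  "norm_seq N p w = Some w' \<Longrightarrow> norm_seq N (map Suc p) (x # w) = Some (x # w')"
  by (induction p arbitrary: w) (auto simp: bind_eq_Some_conv dest: norm_at_Cons)

lemma norm_seq_absorb: "\<exists>p. norm_seq nf p (x # w) = Some (absorb x w)"
proof (cases "(x, w)" rule: absorb.cases)
  case (1 x)
  then show ?thesis by (auto intro: exI[of _ "[]"])
next
  case (2 x y)
  then have "norm_seq nf [1] (x # w) = Some (absorb x w)"
    by (simp add: norm_at_def split: prod.split)
  with 2 show ?thesis by blast
next
  case (3 x y z v)
  \<comment> \<open>The positions trace abc -> ab'c -> ab''c'' and b'c'd -> bcd -> bc'd ->
    b''c''d.\<close>
  then have "norm_seq nf (if x = 0 \<and> y = 1 \<and> z = 4 then [1, 2]
      else if x = 2 \<and> y = 5 \<and> z = 7 then [1, 2, 1] else [1]) (x # w) = Some (absorb x w)"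
    by (auto simp: norm_at_def rule_map_def)
  with 3 show ?thesis by blast
qed

lemma norm_seq_nf: "\<exists>p. norm_seq nf p w = Some (nf w)"
proof (induction w)
  case Nil
  show ?case by (auto intro: exI[of _ "[]"])
next
  case (Cons x w)
  then obtain p where "norm_seq nf p w = Some (nf w)" by blast
  moreover obtain q where "norm_seq nf q (x # nf w) = Some (absorb x (nf w))"
    using norm_seq_absorb by blast
  \<comment> \<open>The tail is normalised first, its positions shifted by one; then
    \<open>x\<close> is absorbed.\<close>
  ultimately have "norm_seq nf (map Suc p @ q) (x # w) = Some (nf (x # w))"
    by (simp add: norm_seq_append norm_seq_Cons)
  then show ?case by blast
qed

lemma normalisation_nf: "normalisation UNIV nf"
proof -
  \<comment> \<open>\<open>nf w\<close> is reached from \<open>w\<close> by steps that preserve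
    \<open>nf\<close> in every context.\<close>
  have "nf (u @ nf w @ v) = nf (u @ w @ v)" for u v w
    using norm_seq_nf nf_norm_seq by blast
  moreover have "nf w = w" if "length w = 1" for w
    using that by (cases w) auto
  ultimately show ?thesis by (simp add: normalisation_def)
qed

lemma normal_word_nf: "normal_word nf w \<longleftrightarrow> irreducible w"
  unfolding normal_word_def using irreducible_nf nf_irreducible by metis

lemma irreducible_iff_factors:
  "irreducible w \<longleftrightarrow> (\<forall>u x v. w = u @ x @ v \<and> length x = 2 \<longrightarrow> irreducible x)"
proof
  assume "irreducible w"
  then show "\<forall>u x v. w = u @ x @ v \<and> length x = 2 \<longrightarrow> irreducible x"
    by (auto simp: successively_append_iff)
next
  assume "\<forall>u x v. w = u @ x @ v \<and> length x = 2 \<longrightarrow> irreducible x"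
  then show "irreducible w"
  proof (induction w rule: induct_list012)
    case (3 x y zs)
    have "irreducible (y # zs)"
    proof (rule "3.IH"(2), intro allI impI)
      fix u p v
      assume "y # zs = u @ p @ v \<and> length p = 2"
      then show "irreducible p"
        using "3.prems"[rule_format, of "x # u" p v] by simp
    qed
    moreover have "irreducible [x, y]"
      using "3.prems"[rule_format, of "[]" "[x, y]" zs] by simp
    ultimately show ?case by simp
  qed auto
qed

lemma quadratic_normalisation_nf: "quadratic_normalisation UNIV nf"
  unfolding quadratic_normalisation_def normal_word_nf
  by (intro conjI ballI normalisation_nf irreducible_iff_factors norm_seq_nf)

lemma norm_at_1: "norm_at nf (Suc 0) [x, y, z] = Some (case rule_map x y of (s, t) \<Rightarrow> [s, t, z])"
  and norm_at_2: "norm_at nf 2 [x, y, z] = Some (case rule_map y z of (s, t) \<Rightarrow> [x, s, t])"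
  by (simp_all add: norm_at_def split: prod.splits)

lemma of_class_nf: "of_class UNIV nf 4 4"
proof -
  have alt: "alternating i j 4 = [i, j, i, j]" for i j
    by (simp add: eval_nat_numeral)
  \<comment> \<open>Four steps are attained on both sides: abc' -> ab'c' -> abc -> ab'c -> ab''c''
    from the left, while b'c'd from the right idles once and then takes three.\<close>
  have "norm_seq nf [1, 2, 1, 2] [x, y, z] = Some (nf [x, y, z])"
    "norm_seq nf [2, 1, 2, 1] [x, y, z] = Some (nf [x, y, z])" for x y z
    by (simp_all add: norm_at_1 norm_at_2 rule_map_def)
  then show ?thesis unfolding of_class_def left_class_def right_class_def alt
    by (auto simp: words_of_length_def length_Suc_conv numeral_3_eq_3)
qed

lemma rewriting_step_rule_map:
  assumes "rule_map s t = (s', t')" "(s', t') \<noteq> (s, t)"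
  shows "(u @ [s, t] @ v, u @ [s', t'] @ v) \<in> rewriting_step UNIV (associated_rules UNIV nf)"
proof -
  have "([s, t], [s', t']) \<in> associated_rules UNIV nf"
    using assms by (auto simp: associated_rules_def)
  then show ?thesis unfolding rewriting_step_def by blast
qed

lemma not_terminating_of_cycle:
  assumes "(x, y) \<in> rewriting_step S R" "(y, z) \<in> rewriting_step S R" "(z, x) \<in> rewriting_step S R"
  shows "\<not> terminating S R"
proof -
  define w where "w n = (if n mod 3 = 0 then x else if n mod 3 = 1 then y else z)" for n :: nat
  have "(w n, w (Suc n)) \<in> rewriting_step S R" for n
    using assms by (auto simp: w_def mod_Suc)
  then show ?thesis unfolding terminating_def by blast
qed

text \<open>After b'c' -> bc, only an a on the left and a d on the right together restore both
  primes, so the loop needs four letters and is invisible to the class conditions.\<close>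

lemma not_terminating_nf: "\<not> terminating UNIV (associated_rules UNIV nf)"
proof (rule not_terminating_of_cycle)
  show "([0, 1, 4, 7], [0, 2, 4, 7]) \<in> rewriting_step UNIV (associated_rules UNIV nf)"
    using rewriting_step_rule_map[of 0 1 0 2 "[]" "[4, 7]"] by (simp add: rule_map_def)
  show "([0, 2, 4, 7], [0, 2, 5, 7]) \<in> rewriting_step UNIV (associated_rules UNIV nf)"
    using rewriting_step_rule_map[of 4 7 5 7 "[0, 2]" "[]"] by (simp add: rule_map_def)
  show "([0, 2, 5, 7], [0, 1, 4, 7]) \<in> rewriting_step UNIV (associated_rules UNIV nf)"
    using rewriting_step_rule_map[of 2 5 1 4 "[0]" "[7]"] by (simp add: rule_map_def)
qed

theorem proposition4p36:
  shows "\<exists>(S :: nat set) (N :: nat list \<Rightarrow> nat list).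
           quadratic_normalisation S N \<and> of_class S N 4 4 \<and>
           \<not> terminating S (associated_rules S N)"
  using quadratic_normalisation_nf of_class_nf not_terminating_nf by blast

end
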